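(* Let $m\ge2$, let $\bar x=\frac{\sqrt2}{2}(0,\dots,0,1)\in\mathbb{R}^{m+1}$, $d=|\bar x|=\frac{\sqrt2}{2}$, and let $M^m_{r,h}$, $\mathcal{I}$, $J_{p,q}$, $Y_{p,q}$, $Z_{p,q}$ and $\psi$ be as defined in the context. For $(p,q)\in\mathcal{I}$ and $(r,h)=\psi(p,q)$ we have $$M^m_{r,h}=\begin{cases}Y_{p,q}(\mathbb{S}^{m-1}\times\bar J_{p,q})\cup Z_{p,q}(\mathbb{S}^{m-1}\times\bar J_{p,q}),&\text{if }(r,h)\ne(d,0),\\[1ex] Y_{1,0}(\mathbb{S}^{m-1}\times(-1,1)),&\text{if }(r,h)=(d,0).\end{cases}$$
   Context: Definition of $M^m_{r,h}$. Let $\phi:\mathbb{S}^{m+1}\times\mathbb{R}\to\mathbb{R}^{m+2}\setminus\{0\}$ be $\phi(x,t)=e^tx$. For $r>0$, $h\ge0$, let $\mathbb{S}^m_{r,h}$ be the $m$-dimensional sphere of radius $r$ centered at $(\bar x,h)\in\mathbb{R}^{m+1}\times\mathbb{R}=\mathbb{R}^{m+2}$ contained in the affine hyperplane $\mathbb{R}^{m+1}\times\{h\}$. Then $M^m_{r,h}:=\phi^{-1}(\mathbb{S}^m_{r,h})$ if $(r,h)\neq(d,0)$ and $M^m_{d,0}:=\phi^{-1}(\mathbb{S}^m_{d,0}\setminus\{0\})$. Let $\mathcal{I}=\{(p,q)\in\mathbb{R}^2: (p-1)^2\le q<p^2\}$. For $(p,q)\in\mathcal{I}$ set $J_{p,q}=\left(-\sqrt{p-\sqrt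 q},\sqrt{p-\sqrt q}\right)$, let $\bar J_{p,q}$ be its closure, and define $h_{p,q}:\bar J_{p,q}\to\mathbb{R}$ by $$h_{p,q}(s)=\sqrt{p-s^2+\sqrt{(p-s^2)^2-q}}.$$ The maps $Y_{p,q},Z_{p,q}:\mathbb{S}^{m-1}\times\bar J_{p,q}\to\mathbb{S}^{m+1}\times\mathbb{R}$ (with $\mathbb{S}^{m-1}\subset\mathbb{R}^m$ and $\mathbb{S}^{m+1}\times\mathbb{R}\subset\mathbb{R}^m\times\mathbb{R}\times\mathbb{R}\times\mathbb{R}$) are $$Y_{p,q}(x,s)=\left(sx,\ \frac{\sqrt2}{2}\left(h_{p,q}(s)+\frac{1-p}{h_{p,q}(s)}\right),\ \frac{\sqrt{q-(p-1)^2}}{\sqrt2\,h_{p,q}(s)},\ \log h_{p,q}(s)\right)$$ and, for $q\ne0$, $$Z_{p,q}(x,s)=\left(sx,\ \frac{\sqrt2}{2}\left(\frac{1-p}{\sqrt q}h_{p,q}(s)+\frac{\sqrt q}{h_{p,q}(s)}\right),\ \frac{\sqrt{q-(p-1)^2}}{\sqrt{2q}}h_{p,q}(s),\ \log\frac{\sqrt q}{h_{p,q}(s)}\right).$$ For $(p,q)=(1,0)$, $Y_{1,0}$ is considered only on $\mathbb{S}^{m-1}\times(-1,1)$, where $h_{1,0}>0$. Finally $\psi:\mathcal{I}\to(0,\infty)\times[0,\infty)$ is the bijection $$\psi(p,q)=\frac{\sqrt2}{2}\left(\sqrt{p^2-q},\ \sqrt{q-(p-1)^2}\right),$$ and $\psi(1,0)=(d,0)$.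 *)

theory Defs
  imports "HOL-Analysis.Analysis"
begin

text \<open>
  \<open>'m\<close> is a finite index type with \<open>CARD('m) = m\<close>, so \<open>real ^ 'm\<close> is \<open>R^m\<close>. The spaces
  \<open>R^(m+1)\<close> and \<open>R^(m+2)\<close> are the products \<open>R^m \<times> R\<close> and \<open>R^m \<times> R \<times> R\<close>, whose library
  norms are the Euclidean ones. Under these identifications a point \<open>((y, u), h)\<close> of
  \<open>R^(m+1) \<times> R\<close> is written \<open>(y, u, h)\<close>.
\<close>

type_synonym 'm E1 = "(real ^ 'm) \<times> real"
type_synonym 'm E2 = "(real ^ 'm) \<times> real \<times> real"

definition xbar :: "('m::finite) E1" where
  "xbar = (sqrt 2 / 2) *\<^sub>R (0, 1)"

definition dbar :: real where
  "dbar = sqrt 2 / 2"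

lemma norm_xbar: "norm (xbar :: ('m::finite) E1) = dbar"
  by (simp add: xbar_def dbar_def norm_Pair)

definition cyl :: "(('m::finite) E2 \<times> real) set" where
  "cyl = sphere 0 1 \<times> UNIV"

definition phi :: "('m::finite) E2 \<times> real \<Rightarrow> 'm E2" where
  "phi = (\<lambda>(x, t). exp t *\<^sub>R x)"

definition slice_sphere :: "real \<Rightarrow> real \<Rightarrow> ('m::finite) E2 set" where
  "slice_sphere r h = {(y, u, v). v = h \<and> (y, u) \<in> sphere xbar r}"

text \<open>The map \<open>phi\<close> is only considered on \<open>cyl\<close>, so preimages are intersected with \<open>cyl\<close>.\<close>

definition M :: "real \<Rightarrow> real \<Rightarrow> (('m::finite) E2 \<times> real) set" where
  "M r h = (if (r, h) \<noteq> (dbar, 0)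
            then phi -` slice_sphere r h \<inter> cyl
            else phi -` (slice_sphere dbar 0 - {0}) \<inter> cyl)"

definition param_set :: "(real \<times> real) set" where
  "param_set = {(p, q). (p - 1)\<^sup>2 \<le> q \<and> q < p\<^sup>2}"

definition J :: "real \<Rightarrow> real \<Rightarrow> real set" where
  "J p q = {- sqrt (p - sqrt q) <..< sqrt (p - sqrt q)}"

definition hfun :: "real \<Rightarrow> real \<Rightarrow> real \<Rightarrow> real" where
  "hfun p q s = sqrt (p - s\<^sup>2 + sqrt ((p - s\<^sup>2)\<^sup>2 - q))"

definition Y :: "real \<Rightarrow> real \<Rightarrow> (real ^ 'm::finite) \<times> real \<Rightarrow> 'm E2 \<times> real" where
  "Y p q = (\<lambda>(x, s).
     ((s *\<^sub>R x,
       sqrt 2 / 2 * (hfun p q s + (1 - p) / hfun p q s),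
       sqrt (q - (p - 1)\<^sup>2) / (sqrt 2 * hfun p q s)),
      ln (hfun p q s)))"

text \<open>\<open>Z p q\<close> is meaningful only for \<open>q \<noteq> 0\<close>; on \<open>param_set\<close> this excludes just \<open>(1, 0)\<close>.\<close>

definition Z :: "real \<Rightarrow> real \<Rightarrow> (real ^ 'm::finite) \<times> real \<Rightarrow> 'm E2 \<times> real" where
  "Z p q = (\<lambda>(x, s).
     ((s *\<^sub>R x,
       sqrt 2 / 2 * ((1 - p) / sqrt q * hfun p q s + sqrt q / hfun p q s),
       sqrt (q - (p - 1)\<^sup>2) / sqrt (2 * q) * hfun p q s),
      ln (sqrt q / hfun p q s)))"

definition psi :: "real \<times> real \<Rightarrow> real \<times> real" where
  "psi = (\<lambda>(p, q). (sqrt 2 / 2) *\<^sub>R (sqrt (p\<^sup>2 - q), sqrt (q - (p - 1)\<^sup>2)))"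

lemma psi_1_0: "psi (1, 0) = (dbar, 0)"
  by (simp add: psi_def dbar_def)

end

theory Submission
  imports Defs
begin

text \<open>
  Write \<open>w = exp t\<close>. On the cylinder, the condition \<open>phi ((y, u, v), t) \<in> slice_sphere r h\<close> is
  linear in \<open>u\<close> and \<open>v\<close> and determines both as functions of \<open>w\<close>; the equation
  \<open>|y|\<^sup>2 + u\<^sup>2 + v\<^sup>2 = 1\<close> then becomes the biquadratic
  \<open>w^4 - 2 (p - |y|\<^sup>2) w\<^sup>2 + q = 0\<close>. Its roots \<open>w\<^sup>2\<close> have product \<open>q\<close>; the larger one is
  \<open>(hfun p q |y|)\<^sup>2\<close> and gives \<open>Y\<close>, the smaller one gives \<open>Z\<close>. They are real iff
  \<open>sqrt q \<le> p - |y|\<^sup>2\<close>, that is \<open>|y| \<in> closure (J p q)\<close>. For \<open>q = 0\<close> the smaller root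
  vanishes and only \<open>Y\<close> remains.
\<close>

text \<open>The formula of \<open>Y\<close> with a free \<open>w\<close> in place of
  \<open>hfun p q s\<close> and \<open>y\<close> in place of \<open>s *\<^sub>R x\<close>; at
  \<open>w = sqrt q / hfun p q s\<close> the same formula gives \<open>Z\<close>.\<close>

definition curve_point :: "real \<Rightarrow> real \<Rightarrow> real \<Rightarrow> real ^ 'm::finite \<Rightarrow> 'm E2 \<times> real" where
  "curve_point p q w y =
     ((y, sqrt 2 / 2 * (w + (1 - p) / w), sqrt (q - (p - 1)\<^sup>2) / (sqrt 2 * w)), ln w)"

section \<open>The parameter domain\<close>

lemma param_set_bounds:
  assumes "(p, q) \<in> param_set"
  shows "(p - 1)\<^sup>2 \<le> q" "q < p\<^sup>2" "0 \<le> q" "0 < p" "sqrt q < p"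
proof -
  show 1: "(p - 1)\<^sup>2 \<le> q" and 2: "q < p\<^sup>2"
    using assms by (auto simp: param_set_def)
  show "0 \<le> q"
    using 1 order_trans zero_le_power2 by blast
  show "0 < p"
    using 1 2 by (simp add: power2_eq_square algebra_simps)
  then show "sqrt q < p"
    using 2 by (simp add: real_less_lsqrt)
qed

text \<open>Adding \<open>p\<^sup>2 - q = 1\<close> and \<open>q = (p - 1)\<^sup>2\<close> gives
  \<open>2 * p - 1 = 1\<close>. This is the injectivity of \<open>psi\<close> at the exceptional
  parameter.\<close>

lemma psi_eq_dbar_0_iff:
  assumes "(p, q) \<in> param_set"
  shows "psi (p, q) = (dbar, 0) \<longleftrightarrow> p = 1 \<and> q = 0"
proof
  assume "psi (p, q) = (dbar, 0)"
  then have "sqrt (p\<^sup>2 - q) = 1" "sqrt (q - (p - 1)\<^sup>2) = 0"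
    by (auto simp: psi_def dbar_def)
  then have "p\<^sup>2 - q = 1" "q - (p - 1)\<^sup>2 = 0"
    by simp_all
  then show "p = 1 \<and> q = 0"
    by (auto simp: power2_eq_square algebra_simps)
qed (simp add: psi_1_0)

lemma param_set_q_0:
  assumes "(p, q) \<in> param_set" "q = 0"
  shows "p = 1"
  using param_set_bounds(1)[OF assms(1)] assms(2) by simp

section \<open>Reduction of the defining equations to a biquadratic\<close>

text \<open>Here \<open>n\<close> stands for \<open>(norm y)\<^sup>2\<close>. Multiplying the
  formulas for \<open>u\<close> and \<open>v\<close> by \<open>sqrt 2 * w\<close> clears
  denominators, and what remains is polynomial algebra.\<close>

lemma sphere_and_slice_iff:
  fixes n u v w p q :: real
  assumes w: "0 < w" and pq: "(p, q) \<in> param_set"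
  shows "n + u\<^sup>2 + v\<^sup>2 = 1 \<and> w * v = sqrt 2 / 2 * sqrt (q - (p - 1)\<^sup>2) \<and>
      w\<^sup>2 * n + (w * u - sqrt 2 / 2)\<^sup>2 = (p\<^sup>2 - q) / 2 \<longleftrightarrow>
    u = sqrt 2 / 2 * (w + (1 - p) / w) \<and> v = sqrt (q - (p - 1)\<^sup>2) / (sqrt 2 * w) \<and>
      (w\<^sup>2)\<^sup>2 - 2 * (p - n) * w\<^sup>2 + q = 0"
    (is "?A \<and> ?B \<and> ?C \<longleftrightarrow> ?D \<and> ?E \<and> ?F")
proof -
  define k where "k = sqrt (q - (p - 1)\<^sup>2)"
  have k2: "k\<^sup>2 = q - (p - 1)\<^sup>2"
    using param_set_bounds(1)[OF pq] by (simp add: k_def)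
  define c where "c = sqrt (2::real)"
  have c: "c * c = 2" "c > 0"
    by (auto simp: c_def)
  have "?D \<longleftrightarrow> c * w * u = c * w * (c / 2 * (w + (1 - p) / w))"
    unfolding c_def[symmetric] using w c(2) by simp
  also have "c * w * (c / 2 * (w + (1 - p) / w)) = (c * c) / 2 * (w * (w + (1 - p) / w))"
    by simp
  also have "\<dots> = w\<^sup>2 + 1 - p"
    unfolding c(1) using w by (simp add: distrib_left power2_eq_square)
  finally have D: "?D \<longleftrightarrow> c * w * u = w\<^sup>2 + 1 - p" .
  have "?B \<longleftrightarrow> c * (w * v) = c * (c / 2 * k)"
    unfolding k_def[symmetric] c_def[symmetric] using c(2)
    by (simp only: mult_cancel_left) (simp add: mult.assoc)
  also have "c * (c / 2 * k) = (c * c) / 2 * k"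
    by simp
  also have "\<dots> = k"
    unfolding c(1) by simp
  finally have B: "?B \<longleftrightarrow> c * w * v = k"
    by (simp add: mult.assoc)
  have E: "?E \<longleftrightarrow> c * w * v = k"
    unfolding k_def[symmetric] c_def[symmetric] using w c(2)
    by (simp add: eq_divide_eq mult.commute)
  have A: "?A \<longleftrightarrow> w\<^sup>2 * (n + u\<^sup>2 + v\<^sup>2) = w\<^sup>2"
    using w by simp
  have C: "?C \<longleftrightarrow> w\<^sup>2 * n + w\<^sup>2 * u\<^sup>2 - c * w * u + 1/2 = (p\<^sup>2 - q) / 2"
    unfolding c_def[symmetric] using c by (simp add: power2_eq_square algebra_simps)
  have eqs: "?A \<and> ?C \<longleftrightarrow> c * w * u = w\<^sup>2 + 1 - p \<and> ?F" if b: "c * w * v = k"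
  proof -
    have "(c * w * v)\<^sup>2 = 2 * (w\<^sup>2 * v\<^sup>2)" "(c * w * u)\<^sup>2 = 2 * (w\<^sup>2 * u\<^sup>2)"
      using c(1) by (simp_all add: power_mult_distrib power2_eq_square[of c])
    then have v: "2 * (w\<^sup>2 * v\<^sup>2) = q - (p - 1)\<^sup>2"
      and u: "(c * w * u)\<^sup>2 = 2 * (w\<^sup>2 * u\<^sup>2)"
      using b k2 by simp_all
    \<comment> \<open>Subtracting the two equations cancels \<open>n\<close> and the square of
      \<open>u\<close>; the square of \<open>v\<close> is known, so a linear equation for
      \<open>u\<close> is left.\<close>
    have "c * w * u = w\<^sup>2 + 1 - p" if ?A ?C
      using that v unfolding A C by (simp add: algebra_simps power2_eq_square)
    \<comment> \<open>With \<open>u\<close> and \<open>v\<close> substituted, both equations turn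
      into the biquadratic.\<close>
    moreover have "?A \<and> ?C \<longleftrightarrow> ?F" if *: "c * w * u = w\<^sup>2 + 1 - p"
    proof -
      have "2 * (w\<^sup>2 * u\<^sup>2) = (w\<^sup>2 + 1 - p)\<^sup>2"
        using u * by simp
      then show ?thesis
        unfolding A C using v * by (auto simp: algebra_simps power2_eq_square)
    qed
    ultimately show ?thesis by blast
  qed
  show ?thesis
    using B D E eqs by blast
qed

lemma norm_Pair_sq: "(norm (a, b))\<^sup>2 = (norm a)\<^sup>2 + (norm b)\<^sup>2"
  by (simp add: norm_Pair)

text \<open>Comparing \<open>fst\<close> is enough, because the last coordinate
  \<open>ln (exp t)\<close> is \<open>t\<close>.\<close>

lemma phi_vimage_iff:
  fixes y :: "real ^ 'm::finite"
  assumes pq: "(p, q) \<in> param_set" and rh: "(r, h) = psi (p, q)"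
  shows "((y, u, v), t) \<in> phi -` slice_sphere r h \<inter> cyl \<longleftrightarrow>
    (y, u, v) = fst (curve_point p q (exp t) y) \<and>
    ((exp t)\<^sup>2)\<^sup>2 - 2 * (p - (norm y)\<^sup>2) * (exp t)\<^sup>2 + q = 0"
proof -
  define w where "w = exp t"
  have w: "w > 0" by (simp add: w_def)
  have r: "r = sqrt 2 / 2 * sqrt (p\<^sup>2 - q)" and h: "h = sqrt 2 / 2 * sqrt (q - (p - 1)\<^sup>2)"
    using rh by (simp_all add: psi_def)
  have r0: "r \<ge> 0" and r2: "r\<^sup>2 = (p\<^sup>2 - q) / 2"
    using param_set_bounds(2)[OF pq] by (simp_all add: r power_mult_distrib power_divide)
  have "(y, u, v) \<in> sphere 0 1 \<longleftrightarrow> (norm (y, u, v))\<^sup>2 = 1\<^sup>2"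
    using norm_ge_zero[of "(y, u, v)"] by (subst power2_eq_iff_nonneg) auto
  also have "\<dots> \<longleftrightarrow> (norm y)\<^sup>2 + u\<^sup>2 + v\<^sup>2 = 1"
    by (simp add: norm_Pair_sq add.assoc)
  finally have 1: "((y, u, v), t) \<in> cyl \<longleftrightarrow> (norm y)\<^sup>2 + u\<^sup>2 + v\<^sup>2 = 1"
    by (simp add: cyl_def)
  have "(w *\<^sub>R y, w * u) \<in> sphere xbar r \<longleftrightarrow> (norm ((w *\<^sub>R y, w * u) - xbar))\<^sup>2 = r\<^sup>2"
    using r0 by (simp add: dist_norm norm_minus_commute power2_eq_iff_nonneg)
  also have "\<dots> \<longleftrightarrow> w\<^sup>2 * (norm y)\<^sup>2 + (w * u - sqrt 2 / 2)\<^sup>2 = (p\<^sup>2 - q) / 2"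
    by (simp add: xbar_def norm_Pair_sq r2 power_mult_distrib)
  finally have 2: "((y, u, v), t) \<in> phi -` slice_sphere r h \<longleftrightarrow>
      w * v = h \<and> w\<^sup>2 * (norm y)\<^sup>2 + (w * u - sqrt 2 / 2)\<^sup>2 = (p\<^sup>2 - q) / 2"
    by (simp add: phi_def slice_sphere_def w_def)
  show ?thesis
    using sphere_and_slice_iff[OF w pq, of "(norm y)\<^sup>2" u v] 1 2
    by (auto simp: curve_point_def h simp flip: w_def)
qed

text \<open>A unit vector times \<open>exp t\<close> is never zero, so both cases of
  \<open>M\<close> reduce to the same preimage.\<close>

lemma phi_nonzero: "z \<in> cyl \<Longrightarrow> phi z \<noteq> 0"
  by (auto simp: cyl_def phi_def zero_prod_def)

lemma M_eq_curve_points: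
  assumes pq: "(p, q) \<in> param_set" and rh: "(r, h) = psi (p, q)"
  shows "(M r h :: ('m::finite E2 \<times> real) set) =
    {curve_point p q w y |w y. 0 < w \<and> (w\<^sup>2)\<^sup>2 - 2 * (p - (norm y)\<^sup>2) * w\<^sup>2 + q = 0}"
    (is "_ = ?R")
proof -
  have "M r h = (phi -` slice_sphere r h \<inter> cyl :: ('m E2 \<times> real) set)"
    using phi_nonzero [where ?'a = 'm] unfolding M_def by (cases "(r, h) = (dbar, 0)") (simp_all, blast)
  moreover have "z \<in> phi -` slice_sphere r h \<inter> cyl \<longleftrightarrow> z \<in> ?R" for z :: "'m E2 \<times> real"
  proof -
    obtain y u v t where z: "z = ((y, u, v), t)"
      by (metis prod.collapse)
    have "z \<in> ?R \<longleftrightarrow> z = curve_point p q (exp t) y \<and>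
        ((exp t)\<^sup>2)\<^sup>2 - 2 * (p - (norm y)\<^sup>2) * (exp t)\<^sup>2 + q = 0"
    proof
      assume "z \<in> ?R"
      then obtain w y' where *: "z = curve_point p q w y'" "0 < w"
        "(w\<^sup>2)\<^sup>2 - 2 * (p - (norm y')\<^sup>2) * w\<^sup>2 + q = 0"
        by blast
      \<comment> \<open>The point determines \<open>y\<close> as its first coordinate and, as
        \<open>w\<close> is positive, \<open>w\<close> through its logarithm.\<close>
      then have "y' = y" "w = exp t"
        using z by (auto simp: curve_point_def)
      then show "z = curve_point p q (exp t) y \<and>
        ((exp t)\<^sup>2)\<^sup>2 - 2 * (p - (norm y)\<^sup>2) * (exp t)\<^sup>2 + q = 0"
        using * by simp
    qed (use exp_gt_zero in blast)
    also have "\<dots> \<longleftrightarrow> z \<in> phi -` slice_sphere r h \<inter> cyl"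
      unfolding z phi_vimage_iff[OF pq rh] by (auto simp: curve_point_def)
    finally show ?thesis by simp
  qed
  ultimately show ?thesis by blast
qed

section \<open>Roots of the biquadratic\<close>

text \<open>The roots have product \<open>q\<close>, so the smaller one is \<open>q\<close> divided
  by the larger, the shape that leads to \<open>Z\<close>. Their sum \<open>2 * b\<close> must be
  positive; for \<open>q = 0\<close> this is stronger than \<open>sqrt q \<le> b\<close>.\<close>

lemma quadratic_pos_root_iff:
  fixes W b q :: real
  assumes W: "0 < W" and q: "0 \<le> q"
  shows "W\<^sup>2 - 2 * b * W + q = 0 \<longleftrightarrow>
    sqrt q \<le> b \<and> 0 < b \<and>
    (W = b + sqrt (b\<^sup>2 - q) \<or> W = q / (b + sqrt (b\<^sup>2 - q)))"
    (is "?L \<longleftrightarrow> ?R")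
proof
  assume ?L
  then have disc: "(W - b)\<^sup>2 = b\<^sup>2 - q"
    by (simp add: power2_eq_square algebra_simps)
  have "W * (2 * b) = W\<^sup>2 + q"
    using \<open>?L\<close> by (simp add: algebra_simps)
  then have "0 < W * (2 * b)"
    using W q by (simp add: add_pos_nonneg)
  then have b: "0 < b"
    using W by (simp add: zero_less_mult_iff)
  have "q \<le> b\<^sup>2"
    using disc zero_le_power2[of "W - b"] by linarith
  then have "sqrt q \<le> b"
    using b by (simp add: real_le_lsqrt)
  define e where "e = sqrt (b\<^sup>2 - q)"
  have e: "e \<ge> 0" "e\<^sup>2 = b\<^sup>2 - q"
    using \<open>q \<le> b\<^sup>2\<close> by (auto simp: e_def)
  have "W - b = e \<or> W - b = - e"
    using disc e by (metis power2_eq_iff)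
  moreover have "W = q / (b + e)" if "W - b = - e"
  proof -
    have "W * (b + e) = q"
      using that e by algebra
    then show ?thesis
      using b e by (simp add: eq_divide_eq)
  qed
  ultimately show ?R
    using b \<open>sqrt q \<le> b\<close> by (auto simp flip: e_def)
next
  assume R: ?R
  then have "q \<le> b\<^sup>2"
    by (simp add: sqrt_le_D)
  define e where "e = sqrt (b\<^sup>2 - q)"
  have e: "e \<ge> 0" "e\<^sup>2 = b\<^sup>2 - q"
    using \<open>q \<le> b\<^sup>2\<close> by (auto simp: e_def)
  have be: "b + e \<noteq> 0"
    using R e by linarith
  have "W = b + e \<or> W = b - e"
  proof -
    have "q / (b + e) = b - e"
      unfolding divide_eq_eq using be e by (simp add: power2_eq_square algebra_simps)
    then show ?thesis
      using R by (auto simp flip: e_def)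
  qed
  then show ?L
    using e by (elim disjE; algebra)
qed

lemma hfun_pos_sq:
  assumes "0 \<le> q" "sqrt q \<le> p - s\<^sup>2" "0 < p - s\<^sup>2"
  shows "0 < hfun p q s"
    and "(hfun p q s)\<^sup>2 = p - s\<^sup>2 + sqrt ((p - s\<^sup>2)\<^sup>2 - q)"
proof -
  have "0 \<le> sqrt ((p - s\<^sup>2)\<^sup>2 - q)"
    using sqrt_le_D[OF assms(2)] by simp
  then have "0 < p - s\<^sup>2 + sqrt ((p - s\<^sup>2)\<^sup>2 - q)"
    using assms(3) by linarith
  then show "0 < hfun p q s"
    and "(hfun p q s)\<^sup>2 = p - s\<^sup>2 + sqrt ((p - s\<^sup>2)\<^sup>2 - q)"
    unfolding hfun_def by simp_all
qed

text \<open>The equation is quadratic in \<open>w\<^sup>2\<close>, and squaring is injective on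
  positive numbers, so each root has exactly one admissible \<open>w\<close>.\<close>

lemma biquadratic_iff:
  assumes q: "0 \<le> q" and w: "0 < w"
  shows "(w\<^sup>2)\<^sup>2 - 2 * (p - s\<^sup>2) * w\<^sup>2 + q = 0 \<longleftrightarrow>
    sqrt q \<le> p - s\<^sup>2 \<and> 0 < p - s\<^sup>2 \<and> (w = hfun p q s \<or> w = sqrt q / hfun p q s)"
proof -
  have "w\<^sup>2 = p - s\<^sup>2 + sqrt ((p - s\<^sup>2)\<^sup>2 - q) \<longleftrightarrow> w = hfun p q s"
    "w\<^sup>2 = q / (p - s\<^sup>2 + sqrt ((p - s\<^sup>2)\<^sup>2 - q)) \<longleftrightarrow> w = sqrt q / hfun p q s"
    if "sqrt q \<le> p - s\<^sup>2" "0 < p - s\<^sup>2"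
  proof -
    note H = hfun_pos_sq[OF q that]
    show "w\<^sup>2 = p - s\<^sup>2 + sqrt ((p - s\<^sup>2)\<^sup>2 - q) \<longleftrightarrow> w = hfun p q s"
      using H w by (metis less_imp_le power2_eq_iff_nonneg)
    have "q / (p - s\<^sup>2 + sqrt ((p - s\<^sup>2)\<^sup>2 - q)) = (sqrt q / hfun p q s)\<^sup>2"
      using q by (simp add: H(2) power_divide)
    then show "w\<^sup>2 = q / (p - s\<^sup>2 + sqrt ((p - s\<^sup>2)\<^sup>2 - q)) \<longleftrightarrow> w = sqrt q / hfun p q s"
      using H(1) w q by (simp add: power2_eq_iff_nonneg)
  qed
  then show ?thesis
    using quadratic_pos_root_iff[of "w\<^sup>2" q "p - s\<^sup>2"] w q by auto
qed

section \<open>Matching the roots with \<open>Y\<close> and \<open>Z\<close>\<close>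

lemma Y_eq_curve_point: "Y p q (x, s) = curve_point p q (hfun p q s) (s *\<^sub>R x)"
  by (simp add: Y_def curve_point_def)

lemma Z_eq_curve_point:
  assumes "0 < q"
  shows "Z p q (x, s) = curve_point p q (sqrt q / hfun p q s) (s *\<^sub>R x)"
  using assms by (simp add: Z_def curve_point_def real_sqrt_mult add.commute)

lemma mem_closure_J_iff:
  assumes "(p, q) \<in> param_set"
  shows "s \<in> closure (J p q) \<longleftrightarrow> sqrt q \<le> p - s\<^sup>2"
proof -
  \<comment> \<open>The interval must be nonempty for its closure to be the closed interval.\<close>
  have pos: "0 < sqrt (p - sqrt q)"
    using param_set_bounds(5)[OF assms] by simp
  then have "closure (J p q) = {- sqrt (p - sqrt q)..sqrt (p - sqrt q)}"
    by (simp add: J_def)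
  then have "s \<in> closure (J p q) \<longleftrightarrow> sqrt (s\<^sup>2) \<le> sqrt (p - sqrt q)"
    by (auto simp: abs_le_iff)
  also have "\<dots> \<longleftrightarrow> sqrt q \<le> p - s\<^sup>2"
    unfolding real_sqrt_le_iff by linarith
  finally show ?thesis .
qed

text \<open>Polar coordinates; at the origin any unit vector serves as direction.\<close>

lemma ex_unit_vector: "\<exists>x :: real ^ 'm::finite. norm x = 1 \<and> y = norm y *\<^sub>R x"
proof (cases "y = 0")
  case True
  obtain x :: "real ^ 'm" where "norm x = 1"
    using vector_choose_size[of 1] by auto
  then show ?thesis
    using True by auto
next
  case False
  then have "norm (y /\<^sub>R norm y) = 1 \<and> y = norm y *\<^sub>R (y /\<^sub>R norm y)"
    by simp
  then show ?thesis
    by blast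
qed

text \<open>If \<open>q = 0\<close>, the case \<open>w = sqrt q / hfun p q s\<close> is excluded by \<open>0 < w\<close>.\<close>

lemma curve_points_eq:
  assumes q: "0 \<le> q"
  shows "{curve_point p q w y |w y. 0 < w \<and> (w\<^sup>2)\<^sup>2 - 2 * (p - (norm y)\<^sup>2) * w\<^sup>2 + q = 0} =
    {curve_point p q w (s *\<^sub>R x) |w x (s::real). norm (x :: real ^ 'm::finite) = 1 \<and>
      sqrt q \<le> p - s\<^sup>2 \<and> 0 < p - s\<^sup>2 \<and>
      (w = hfun p q s \<or> 0 < q \<and> w = sqrt q / hfun p q s)}" (is "?L = ?R")
proof (intro equalityI subsetI)
  fix z assume "z \<in> ?L"
  then obtain w y where z: "z = curve_point p q w y" and w: "0 < w"
    and eq: "(w\<^sup>2)\<^sup>2 - 2 * (p - (norm y)\<^sup>2) * w\<^sup>2 + q = 0"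
    by blast
  obtain x :: "real ^ 'm" where x: "norm x = 1" "y = norm y *\<^sub>R x"
    using ex_unit_vector by blast
  have "0 < q" if "w = sqrt q / hfun p q (norm y)"
    using that w q by (cases "q = 0") auto
  moreover have "z = curve_point p q w (norm y *\<^sub>R x)"
    using z x(2) by simp
  ultimately show "z \<in> ?R"
    using x(1) eq[unfolded biquadratic_iff[OF q w]] by blast
next
  fix z assume "z \<in> ?R"
  then obtain w x s where z: "z = curve_point p q w (s *\<^sub>R x)" and x: "norm (x :: real ^ 'm) = 1"
    and s: "sqrt q \<le> p - s\<^sup>2" "0 < p - s\<^sup>2"
    and ww: "w = hfun p q s \<or> 0 < q \<and> w = sqrt q / hfun p q s"
    by blast
  have w: "0 < w"
    using ww hfun_pos_sq(1)[OF q s] by auto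
  \<comment> \<open>Negative \<open>s\<close> is allowed here, since only its square enters the
    equation.\<close>
  have "(norm (s *\<^sub>R x))\<^sup>2 = s\<^sup>2"
    using x by simp
  then show "z \<in> ?L"
    using biquadratic_iff[OF q w, of p s] s ww w z by fastforce
qed

theorem lemma14:
  fixes p q r h :: real
  assumes "CARD('m::finite) \<ge> 2"
    and "(p, q) \<in> param_set"
    and "(r, h) = psi (p, q)"
  shows "(M r h :: ('m E2 \<times> real) set) =
    (if (r, h) \<noteq> (dbar, 0)
     then Y p q ` (sphere 0 1 \<times> closure (J p q)) \<union> Z p q ` (sphere 0 1 \<times> closure (J p q))
     else Y 1 0 ` (sphere 0 1 \<times> {-1<..<1}))"
proof -
  note pq = assms(2)
  note b = param_set_bounds[OF pq]
  note M = M_eq_curve_points[OF pq assms(3), where 'm = 'm, unfolded curve_points_eq[OF b(3)]]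
  show ?thesis
  proof (cases "(r, h) = (dbar, 0)")
    case True
    then have [simp]: "p = 1" "q = 0"
      using psi_eq_dbar_0_iff[OF pq] assms(3) by auto
    \<comment> \<open>For \<open>q = 0\<close> the strict bound \<open>0 < p - s\<^sup>2\<close> is
      the decisive one, hence the open interval.\<close>
    have "s \<in> {-1<..<1} \<longleftrightarrow> 0 < 1 - s\<^sup>2" for s :: real
      by (auto simp: abs_square_less_1 abs_less_iff)
    then have "Y 1 0 ` (sphere 0 1 \<times> {-1<..<1}) = (M r h :: ('m E2 \<times> real) set)"
      unfolding M by (force simp: Y_eq_curve_point image_def)
    then show ?thesis
      using True by simp
  next
    case False
    then have "q \<noteq> 0"
      using psi_eq_dbar_0_iff[OF pq] param_set_q_0[OF pq] assms(3) by auto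
    then have q: "0 < q"
      using b(3) by simp
    \<comment> \<open>For \<open>q > 0\<close> the strict bound follows from
      \<open>sqrt q \<le> p - s\<^sup>2\<close>, hence the closed interval.\<close>
    have J: "s \<in> closure (J p q) \<longleftrightarrow> sqrt q \<le> p - s\<^sup>2 \<and> 0 < p - s\<^sup>2" for s
      unfolding mem_closure_J_iff[OF pq] using real_sqrt_gt_zero[OF q] by linarith
    have "Y p q ` (sphere 0 1 \<times> closure (J p q)) \<union> Z p q ` (sphere 0 1 \<times> closure (J p q)) =
        (M r h :: ('m E2 \<times> real) set)" (is "?L = _")
    proof (intro equalityI subsetI)
      fix z assume "z \<in> ?L"
      then show "z \<in> M r h"
        unfolding M using q by (force simp: J Y_eq_curve_point Z_eq_curve_point)
    next
      fix z :: "'m E2 \<times> real" assume "z \<in> M r h"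
      then obtain w x s where *: "z = curve_point p q w (s *\<^sub>R x)" "norm x = 1"
        "s \<in> closure (J p q)" "w = hfun p q s \<or> w = sqrt q / hfun p q s"
        unfolding M J by blast
      then have "z = Y p q (x, s) \<or> z = Z p q (x, s)"
        using q by (auto simp: Y_eq_curve_point Z_eq_curve_point)
      then show "z \<in> ?L"
        using * by auto
    qed
    then show ?thesis
      using False by simp
  qed
qed

end
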